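(* Let $m\geqslant 2$ and $k\geqslant 2$. The shortest pair of distinct factors of $\mathbf{t}_m$ that are $k$-binomially equivalent have length $2m^{k-1}$. In particular, for every length $n<2m^{k-1}$, the $k$-binomial complexity $b^{(k)}_{\mathbf{t}_m}(n)$ coincides with the factor complexity $p_{\mathbf{t}_m}(n)$.
   Context: Let $\mathcal{A}_m=\{0,1,\ldots,m-1\}$, identified with $\mathbb{Z}/m\mathbb{Z}$ (all letter arithmetic is modulo $m$). Let $\sigma_m:\mathcal{A}_m^*\to\mathcal{A}_m^*$ be the morphism $\sigma_m(i)=i\,(i+1)\cdots(i+m-1)$, and let $\mathbf{t}_m=\lim_{j\to\infty}\sigma_m^j(0)$ be the generalized Thue--Morse word. A factor of a word is a block of consecutive letters; a subword is a (not necessarily contiguous) subsequence. For words $u,w$, the binomial coefficient $\binom{u}{w}$ is the number of occurrences of $w$ as a subword of $u$. Two words $u,v$ are $k$-binomially equivalent, $u\sim_k v$, if $\binom{u}{x}=\binom{v}{x}$ for all words $x$ of length at most $k$. The $k$-binomial complexity $b^{(k)}_{\mathbf{t}_m}(n)$ is the number of $\sim_k$-classes of the set of factors of length $n$ of $\mathbf{t}_m$, and $p_{\mathbf{t}_m}(n)$ is the number of factors of length $n$ of $\mathbf{t}_m$. *)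

theory Defs
  imports Complex_Main "HOL-Library.Sublist"
begin

text \<open>Letters of the alphabet \<open>{0, \<dots>, m - 1}\<close> are natural numbers, finite words are lists
  and infinite words are functions on \<open>nat\<close>, indexed from \<open>0\<close>.\<close>

definition sigma :: "nat \<Rightarrow> nat list \<Rightarrow> nat list" where
  "sigma m w = concat (map (\<lambda>i. map (\<lambda>r. (i + r) mod m) [0..<m]) w)"

text \<open>Letterwise limit of a sequence of finite words; it is meaningful only if every position is
  eventually present and constant. For the words \<open>\<sigma>\<^sub>m\<^sup>j(0)\<close> this is \<open>eventually_thue_morse\<close> below.\<close>

definition word_lim :: "(nat \<Rightarrow> 'a list) \<Rightarrow> nat \<Rightarrow> 'a" where
  "word_lim W n = (THE a. \<forall>\<^sub>F j in sequentially. n < length (W j) \<and> W j ! n = a)"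

definition thue_morse :: "nat \<Rightarrow> nat \<Rightarrow> nat" where
  "thue_morse m = word_lim (\<lambda>j. (sigma m ^^ j) [0])"

definition factors :: "(nat \<Rightarrow> 'a) \<Rightarrow> 'a list set" where
  "factors x = {map x [i..<i + n] | i n. True}"

definition factors_of_length :: "(nat \<Rightarrow> 'a) \<Rightarrow> nat \<Rightarrow> 'a list set" where
  "factors_of_length x n = {w \<in> factors x. length w = n}"

text \<open>An occurrence of \<open>w\<close> as a subword of \<open>u\<close> is the set of positions of \<open>u\<close> that it uses.\<close>

definition word_binomial :: "'a list \<Rightarrow> 'a list \<Rightarrow> nat" where
  "word_binomial u w = card {I. I \<subseteq> {..<length u} \<and> nths u I = w}"

text \<open>The words \<open>x\<close> below range over the whole letter type; letters that occur in neither
  \<open>u\<close> nor \<open>v\<close> contribute only the trivial condition \<open>0 = 0\<close>.\<close>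

definition binomially_equivalent :: "nat \<Rightarrow> 'a list \<Rightarrow> 'a list \<Rightarrow> bool" where
  "binomially_equivalent k u v \<longleftrightarrow>
     (\<forall>x. length x \<le> k \<longrightarrow> word_binomial u x = word_binomial v x)"

definition binomial_complexity :: "nat \<Rightarrow> (nat \<Rightarrow> 'a) \<Rightarrow> nat \<Rightarrow> nat" where
  "binomial_complexity k x n =
     card (factors_of_length x n // {(u, v). u \<in> factors_of_length x n \<and>
       v \<in> factors_of_length x n \<and> binomially_equivalent k u v})"

definition factor_complexity :: "(nat \<Rightarrow> 'a) \<Rightarrow> nat \<Rightarrow> nat" where
  "factor_complexity x n = card (factors_of_length x n)"

lemma sigma_append: "sigma m (u @ v) = sigma m u @ sigma m v"
  by (simp add: sigma_def)

lemma funpow_sigma_append: "(sigma m ^^ j) (u @ v) = (sigma m ^^ j) u @ (sigma m ^^ j) v"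
  by (induction j) (simp_all add: sigma_append)

lemma length_sigma: "length (sigma m w) = m * length w"
  by (induction w) (simp_all add: sigma_def)

lemma length_funpow_sigma: "length ((sigma m ^^ j) w) = m ^ j * length w"
  by (induction j) (simp_all add: length_sigma)

lemma prefix_funpow_sigma:
  assumes "m \<ge> 1" "i \<le> j"
  shows "prefix ((sigma m ^^ i) [0]) ((sigma m ^^ j) [0])"
  using assms(2)
proof (induction j rule: dec_induct)
  case base
  show ?case by simp
next
  case (step j)
  have "sigma m [0] = [0] @ map (\<lambda>r. r mod m) [1..<m]"
    using assms(1) by (simp add: sigma_def upt_conv_Cons)
  then have "(sigma m ^^ Suc j) [0]
      = (sigma m ^^ j) [0] @ (sigma m ^^ j) (map (\<lambda>r. r mod m) [1..<m])"
    by (simp only: funpow_Suc_right comp_apply funpow_sigma_append)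
  then have "prefix ((sigma m ^^ j) [0]) ((sigma m ^^ Suc j) [0])"
    by (rule prefixI)
  then show ?case
    using step.IH prefix_order.trans by blast
qed

lemma eventually_thue_morse:
  assumes "m \<ge> 2"
  shows "\<forall>\<^sub>F j in sequentially.
    n < length ((sigma m ^^ j) [0]) \<and> (sigma m ^^ j) [0] ! n = thue_morse m n"
proof -
  define W where "W j = (sigma m ^^ j) [0]" for j
  have "n < 2 ^ n" by (rule less_exp)
  also have "(2::nat) ^ n \<le> m ^ n" using assms by (intro power_mono) simp_all
  finally have len: "n < length (W n)"
    by (simp add: W_def length_funpow_sigma)
  have "n < length (W j) \<and> W j ! n = W n ! n" if "j \<ge> n" for j
    using prefix_funpow_sigma[of m n j] that assms len
    by (auto simp: W_def prefix_def nth_append)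
  then have ev: "\<forall>\<^sub>F j in sequentially. n < length (W j) \<and> W j ! n = W n ! n"
    by (rule eventually_sequentiallyI)
  have "b = a" if "\<forall>\<^sub>F j in sequentially. n < length (W j) \<and> W j ! n = a"
      "\<forall>\<^sub>F j in sequentially. n < length (W j) \<and> W j ! n = b" for a b
  proof -
    from that have "\<forall>\<^sub>F j in sequentially. b = a"
      by eventually_elim simp
    then show ?thesis by simp
  qed
  then have "thue_morse m n = W n ! n"
    unfolding thue_morse_def word_lim_def W_def[symmetric] using ev
    by (intro the_equality) blast+
  then show ?thesis using ev by (simp add: W_def)
qed

end

theory Submission
  imports Defs
begin

text \<open>Existence: if \<open>X \<sim>\<^sub>k Y\<close> then \<open>X Y \<sim>\<^sub>k\<^sub>+\<^sub>1 Y X\<close>, so induction on \<open>k\<close> gives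
  \<open>\<sigma>\<^sup>k(a) \<sim>\<^sub>k \<sigma>\<^sup>k(b)\<close> for all letters, and \<open>\<sigma>\<^sup>k\<^sup>-\<^sup>1(01) \<sim>\<^sub>k \<sigma>\<^sup>k\<^sup>-\<^sup>1(10)\<close>.

  Minimality: if \<open>u \<sim>\<^sub>k v\<close>, then all moments \<open>\<Sum>\<^sub>i i\<^sup>j f(u\<^sub>i)\<close> with \<open>j < k\<close> agree for \<open>u\<close> and \<open>v\<close>, for every
  function \<open>f\<close> on letters. This weaker relation suffices for the lower bound, by induction on \<open>k\<close>.
  Cancel common prefixes and suffixes, so that \<open>u\<close> and \<open>v\<close> differ at both ends. Summation by parts
  along the blocks \<open>\<sigma>(b)\<close> then shows that moments of order \<open>0\<close> and \<open>1\<close> can agree only if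
  both words start and end at block boundaries, so \<open>u = \<sigma>(u')\<close> and \<open>v = \<sigma>(v')\<close>. The
  same telescoping with powers \<open>i\<^sup>j\<close> shows that the moments of \<open>u'\<close> and \<open>v'\<close> agree up to one order
  less.\<close>


section \<open>Binomial coefficients of words\<close>

lemma word_binomial_Nil [simp]: "word_binomial u [] = 1"
proof -
  have "{I. I \<subseteq> {..<length u} \<and> nths u I = []} = {{}}"
  proof (intro equalityI subsetI)
    fix I assume I: "I \<in> {I. I \<subseteq> {..<length u} \<and> nths u I = []}"
    then have "set (nths u I) = {}" by simp
    then have "\<forall>i<length u. i \<notin> I" by (auto simp: set_nths)
    with I show "I \<in> {{}}" by auto
  qed simp
  then show ?thesis by (simp add: word_binomial_def)
qed

lemma word_binomial_Nil_left: "word_binomial [] w = of_bool (w = [])"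
  by (cases w) (auto simp: word_binomial_def)

text \<open>Pascal's rule: an occurrence either avoids the last position or uses it for its last
  letter. Later counts by induction on the word rest on this recursion.\<close>

lemma word_binomial_snoc:
  "word_binomial (u @ [b]) (x @ [a]) = word_binomial u (x @ [a]) + of_bool (a = b) * word_binomial u x"
proof -
  let ?n = "length u"
  define S where "S w = {I. I \<subseteq> {..<?n} \<and> nths u I = w}" for w
  have fin: "finite (S w)" for w
    by (rule finite_subset[of _ "Pow {..<?n}"]) (auto simp: S_def)
  have without: "nths (u @ [b]) I = nths u I" if "I \<subseteq> {..<?n}" for I
    using that by (auto simp: nths_append)
  have with_last: "nths (u @ [b]) (insert ?n I) = nths u I @ [b]" if "I \<subseteq> {..<?n}" for I
  proof -
    have "nths u (insert ?n I) = nths u I"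
      unfolding nths_def by (intro arg_cong[of _ _ "map fst"] filter_cong refl) (auto simp: set_zip)
    then show ?thesis by (simp add: nths_append)
  qed
  have "{I. I \<subseteq> {..<length (u @ [b])} \<and> nths (u @ [b]) I = x @ [a]}
      = S (x @ [a]) \<union> (if a = b then insert ?n ` S x else {})" (is "?L = ?R")
  proof (intro equalityI subsetI)
    fix I assume I: "I \<in> ?L"
    define J where "J = I - {?n}"
    have J: "J \<subseteq> {..<?n}" using I by (auto simp: J_def)
    show "I \<in> ?R"
    proof (cases "?n \<in> I")
      case True
      then have "I = insert ?n J" by (auto simp: J_def)
      then show ?thesis using I J with_last[OF J] by (auto simp: S_def)
    next
      case False
      then have "I = J" by (auto simp: J_def)
      then show ?thesis using I J without[OF J] by (auto simp: S_def)
    qed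
  next
    fix I assume "I \<in> ?R"
    then show "I \<in> ?L"
      by (auto simp: S_def without with_last split: if_splits)
  qed
  moreover have "S (x @ [a]) \<inter> insert ?n ` S x = {}"
    by (auto simp: S_def)
  moreover have "inj_on (insert ?n) (S x)"
  proof (rule inj_onI)
    fix I J assume "I \<in> S x" "J \<in> S x" and eq: "insert ?n I = insert ?n J"
    then have "?n \<notin> I" "?n \<notin> J" by (auto simp: S_def)
    then show "I = J" using eq by (rule insert_ident[THEN iffD1])
  qed
  ultimately show ?thesis
    using fin by (auto simp: word_binomial_def S_def[symmetric] card_Un_disjoint card_image)
qed

text \<open>Every occurrence splits at the seam: a prefix of \<open>x\<close> is read in
  \<open>u\<close> and the remaining suffix in \<open>v\<close>.\<close>

lemma word_binomial_append:
  "word_binomial (u @ v) x = (\<Sum>i\<le>length x. word_binomial u (take i x) * word_binomial v (drop i x))"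
proof (induction v arbitrary: x rule: rev_induct)
  case Nil
  have "(\<Sum>i\<le>length x. word_binomial u (take i x) * word_binomial [] (drop i x))
      = (\<Sum>i\<in>{length x}. word_binomial u (take i x) * word_binomial [] (drop i x))"
    by (rule sum.mono_neutral_right) (auto simp: word_binomial_Nil_left)
  then show ?case by simp
next
  case (snoc b v)
  show ?case
  proof (cases x rule: rev_cases)
    case Nil
    then show ?thesis by simp
  next
    case (snoc y a)
    have "word_binomial (u @ v @ [b]) x
        = word_binomial (u @ v) x + of_bool (a = b) * word_binomial (u @ v) y"
      using word_binomial_snoc[of "u @ v" b y a] snoc by simp
    also have "\<dots> = (\<Sum>i\<le>length x. word_binomial u (take i x) * word_binomial v (drop i x))
        + of_bool (a = b) * (\<Sum>i\<le>length y. word_binomial u (take i y) * word_binomial v (drop i y))"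
      by (simp only: snoc.IH)
    also have "\<dots> = (\<Sum>i\<le>length x. word_binomial u (take i x) * word_binomial (v @ [b]) (drop i x))"
      by (simp add: snoc word_binomial_snoc algebra_simps sum.distrib sum_distrib_left)
    finally show ?thesis .
  qed
qed

section \<open>Binomial equivalence\<close>

lemma binomially_equivalent_refl: "binomially_equivalent k u u"
  by (simp add: binomially_equivalent_def)

lemma binomially_equivalent_sym:
  "binomially_equivalent k u v \<Longrightarrow> binomially_equivalent k v u"
  by (simp add: binomially_equivalent_def)

lemma binomially_equivalent_trans [trans]:
  "binomially_equivalent k u v \<Longrightarrow> binomially_equivalent k v w \<Longrightarrow> binomially_equivalent k u w"
  by (simp add: binomially_equivalent_def)

lemma binomially_equivalent_append:
  assumes "binomially_equivalent k u u'" "binomially_equivalent k v v'"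
  shows "binomially_equivalent k (u @ v) (u' @ v')"
  using assms unfolding binomially_equivalent_def word_binomial_append
  by (intro allI impI sum.cong refl) simp

text \<open>Sum over the cuts of \<open>x\<close>. At an inner cut both pieces have length at most
  \<open>k\<close>, so \<open>u\<close> and \<open>v\<close> may be exchanged in the product. The
  two extreme cuts contribute the coefficients of \<open>x\<close> in \<open>u\<close> and in
  \<open>v\<close>, whose sum is symmetric.\<close>

lemma binomially_equivalent_commute:
  assumes "binomially_equivalent k u v"
  shows "binomially_equivalent (Suc k) (u @ v) (v @ u)"
  unfolding binomially_equivalent_def
proof (intro allI impI)
  fix x :: "'a list" assume len: "length x \<le> Suc k"
  show "word_binomial (u @ v) x = word_binomial (v @ u) x"
  proof (cases "x = []")
    case False
    have split: "(\<Sum>i\<le>length x. g i) = g 0 + g (length x) + (\<Sum>i\<in>{1..<length x}. g i)"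
      for g :: "nat \<Rightarrow> nat"
    proof -
      have "{..length x} = insert 0 (insert (length x) {1..<length x})"
        using False by (auto simp: Suc_le_eq)
      then show ?thesis using False by simp
    qed
    have "word_binomial u (take i x) * word_binomial v (drop i x)
        = word_binomial v (take i x) * word_binomial u (drop i x)" if "i \<in> {1..<length x}" for i
    proof -
      have "length (take i x) \<le> k" "length (drop i x) \<le> k" using that len by auto
      then show ?thesis using assms by (simp only: binomially_equivalent_def)
    qed
    then show ?thesis by (simp add: word_binomial_append split)
  qed simp
qed

text \<open>The word \<open>u\<close> moves past the factors one at a time. Only its own equivalence
  with each factor is used.\<close>

lemma binomially_equivalent_commute_concat:
  assumes "\<And>v. v \<in> set vs \<Longrightarrow> binomially_equivalent k u v"
  shows "binomially_equivalent (Suc k) (u @ concat vs) (concat vs @ u)"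
  using assms
proof (induction vs)
  case Nil
  show ?case by (simp add: binomially_equivalent_refl)
next
  case (Cons v vs)
  have "binomially_equivalent (Suc k) ((u @ v) @ concat vs) ((v @ u) @ concat vs)"
    using Cons.prems
    by (intro binomially_equivalent_append binomially_equivalent_commute binomially_equivalent_refl) simp
  also have "binomially_equivalent (Suc k) ((v @ u) @ concat vs) (v @ concat vs @ u)"
    using Cons by (auto intro!: binomially_equivalent_append binomially_equivalent_refl)
  finally show ?case by simp
qed

lemma funpow_sigma_concat: "(sigma m ^^ j) w = concat (map (\<lambda>c. (sigma m ^^ j) [c]) w)"
proof (induction w)
  case Nil
  show ?case by (induction j) (simp_all add: sigma_def)
next
  case (Cons c w)
  then show ?case using funpow_sigma_append[of j m "[c]" w] by simp
qed

text \<open>Blocks of cyclically neighbouring letters are rotations of each other by one place.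
  Writing letters as \<open>a mod m\<close> includes the wrap from m - 1 to 0.\<close>

lemma sigma_Cons_rotate:
  assumes "m \<ge> 1"
  obtains w where "sigma m [a mod m] = (a mod m) # w" "sigma m [Suc a mod m] = w @ [a mod m]"
    "set w \<subseteq> {..<m}"
proof -
  obtain n where n: "m = Suc n" using assms by (cases m) auto
  let ?w = "map (\<lambda>r. Suc (a + r) mod m) [0..<n]"
  have "sigma m [a mod m] = map (\<lambda>r. (a + r) mod m) [0..<m]"
    by (simp add: sigma_def mod_add_left_eq)
  also have "[0..<m] = 0 # map Suc [0..<n]"
    by (simp add: n upt_conv_Cons map_Suc_upt del: upt_Suc)
  finally have 1: "sigma m [a mod m] = (a mod m) # ?w" by (simp add: comp_def)
  have "sigma m [Suc a mod m] = map (\<lambda>r. (Suc a + r) mod m) [0..<m]"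
    by (simp add: sigma_def mod_add_left_eq del: add_Suc)
  also have "\<dots> = ?w @ [(a + m) mod m]"
    by (simp add: n del: mod_add_self2)
  finally have 2: "sigma m [Suc a mod m] = ?w @ [a mod m]" by simp
  show ?thesis
    by (rule that[OF 1 2]) (use assms in auto)
qed

text \<open>The images of two letters are cyclic rotations of the same product of blocks, and blocks that
  are equivalent at level \<open>k\<close> commute at level \<open>k + 1\<close>.\<close>

lemma binomially_equivalent_funpow_sigma:
  assumes "m \<ge> 1" "a < m" "b < m"
  shows "binomially_equivalent k ((sigma m ^^ k) [a]) ((sigma m ^^ k) [b])"
  using assms(2,3)
proof (induction k arbitrary: a b)
  case 0
  show ?case by (simp add: binomially_equivalent_def)
next
  case (Suc k)
  have step: "binomially_equivalent (Suc k) ((sigma m ^^ Suc k) [c mod m]) ((sigma m ^^ Suc k) [Suc c mod m])"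
    for c
  proof -
    obtain w where w: "sigma m [c mod m] = (c mod m) # w" "sigma m [Suc c mod m] = w @ [c mod m]"
      "set w \<subseteq> {..<m}"
      using sigma_Cons_rotate[OF assms(1)] by metis
    have "binomially_equivalent (Suc k)
       ((sigma m ^^ k) [c mod m] @ concat (map (\<lambda>c. (sigma m ^^ k) [c]) w))
       (concat (map (\<lambda>c. (sigma m ^^ k) [c]) w) @ (sigma m ^^ k) [c mod m])"
      using w(3) assms(1) by (intro binomially_equivalent_commute_concat) (auto intro!: Suc.IH)
    also have "(sigma m ^^ k) [c mod m] @ concat (map (\<lambda>c. (sigma m ^^ k) [c]) w) = (sigma m ^^ Suc k) [c mod m]"
      by (simp only: funpow_Suc_right comp_apply w(1) funpow_sigma_concat[of k m "(c mod m) # w"]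
          list.map concat.simps)
    also have "concat (map (\<lambda>c. (sigma m ^^ k) [c]) w) @ (sigma m ^^ k) [c mod m] = (sigma m ^^ Suc k) [Suc c mod m]"
      by (simp only: funpow_Suc_right comp_apply w(2) funpow_sigma_append
          funpow_sigma_concat[of k m w])
    finally show ?thesis .
  qed
  \<comment> \<open>Steps between neighbours connect 0 with every letter, so any two letters are
    compared through 0.\<close>
  have zero: "binomially_equivalent (Suc k) ((sigma m ^^ Suc k) [0]) ((sigma m ^^ Suc k) [c mod m])" for c
  proof (induction c)
    case 0
    show ?case by (simp only: mod_0 binomially_equivalent_refl)
  next
    case (Suc c)
    then show ?case using step[of c] by (rule binomially_equivalent_trans)
  qed
  have "binomially_equivalent (Suc k) ((sigma m ^^ Suc k) [a]) ((sigma m ^^ Suc k) [0])"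
    using zero[of a] Suc.prems(1) by (simp only: mod_less binomially_equivalent_sym)
  also have "binomially_equivalent (Suc k) ((sigma m ^^ Suc k) [0]) ((sigma m ^^ Suc k) [b])"
    using zero[of b] Suc.prems(2) by (simp only: mod_less)
  finally show ?case .
qed

section \<open>The generalized Thue--Morse word\<close>

lemma map_upt_in_factors: "map x [i..<i + n] \<in> factors x"
  by (auto simp: factors_def)

lemma nth_sigma:
  assumes "q < length w" "r < m"
  shows "sigma m w ! (m * q + r) = (w ! q + r) mod m"
  using assms(1)
proof (induction w arbitrary: q)
  case (Cons c w)
  have S: "sigma m (c # w) = map (\<lambda>r. (c + r) mod m) [0..<m] @ sigma m w"
    by (simp add: sigma_def)
  show ?case
  proof (cases q)
    case 0
    then show ?thesis using assms(2) by (simp add: S nth_append)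
  next
    case (Suc p)
    then show ?thesis using Cons.IH[of p] Cons.prems
      by (simp add: S nth_append add.assoc)
  qed
qed simp

lemma thue_morse_0:
  assumes "m \<ge> 2"
  shows "thue_morse m 0 = 0"
proof -
  have "\<forall>\<^sub>F j in sequentially. thue_morse m 0 = 0"
    using eventually_thue_morse[OF assms, of 0]
  proof eventually_elim
    case (elim j)
    have "prefix [0] ((sigma m ^^ j) [0])"
      using prefix_funpow_sigma[of m 0 j] assms by simp
    then show ?case using elim by (auto simp: prefix_def)
  qed
  then show ?thesis by simp
qed

lemma thue_morse_rec:
  assumes "m \<ge> 2" "r < m"
  shows "thue_morse m (m * q + r) = (thue_morse m q + r) mod m"
proof -
  \<comment> \<open>The index is shifted so that the word at level \<open>Suc j\<close> is the image
    under \<open>sigma\<close> of the one at level \<open>j\<close>; both limits are then read at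
    the same \<open>j\<close>.\<close>
  have "\<forall>\<^sub>F j in sequentially. m * q + r < length ((sigma m ^^ Suc j) [0]) \<and>
      (sigma m ^^ Suc j) [0] ! (m * q + r) = thue_morse m (m * q + r)"
    using eventually_thue_morse[OF assms(1), of "m * q + r"]
    by (rule eventually_sequentially_Suc[THEN iffD2])
  then have "\<forall>\<^sub>F j in sequentially. thue_morse m (m * q + r) = (thue_morse m q + r) mod m"
    using eventually_thue_morse[OF assms(1), of q]
    by eventually_elim (use assms(2) in \<open>simp add: nth_sigma\<close>)
  then show ?thesis by simp
qed

lemma thue_morse_less:
  assumes "m \<ge> 2"
  shows "thue_morse m n < m"
  using thue_morse_rec[OF assms, of "n mod m" "n div m"] assms by simp

lemma sigma_map_thue_morse:
  assumes "m \<ge> 2"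
  shows "sigma m (map (thue_morse m) [i..<i + n]) = map (thue_morse m) [m * i..<m * i + m * n]"
proof (rule nth_equalityI)
  fix p assume "p < length (sigma m (map (thue_morse m) [i..<i + n]))"
  then have p: "p < m * n" by (simp add: length_sigma)
  then have q: "p div m < n" using assms by (simp add: less_mult_imp_div_less mult.commute)
  have "sigma m (map (thue_morse m) [i..<i + n]) ! (m * (p div m) + p mod m)
      = (thue_morse m (i + p div m) + p mod m) mod m"
    using q assms by (subst nth_sigma) auto
  also have "\<dots> = thue_morse m (m * (i + p div m) + p mod m)"
    using assms by (subst thue_morse_rec) auto
  also have "m * (i + p div m) + p mod m = m * i + p" by (simp add: algebra_simps)
  finally show "sigma m (map (thue_morse m) [i..<i + n]) ! p
      = map (thue_morse m) [m * i..<m * i + m * n] ! p"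
    using p by simp
qed (simp add: length_sigma)

lemma funpow_sigma_factors:
  assumes "m \<ge> 2" "w \<in> factors (thue_morse m)"
  shows "(sigma m ^^ k) w \<in> factors (thue_morse m)"
proof (induction k)
  case 0
  then show ?case using assms(2) by simp
next
  case (Suc k)
  then obtain i n where "(sigma m ^^ k) w = map (thue_morse m) [i..<i + n]"
    by (auto simp: factors_def)
  then show ?case
    using sigma_map_thue_morse[OF assms(1), of i n]
    by (simp only: funpow.simps comp_apply map_upt_in_factors)
qed

text \<open>The letter at a position is the sum of its base-m digits modulo m. Each appended digit m
  - 1 lowers this sum by one, hence the subtraction over the integers.\<close>

lemma thue_morse_trailing:
  assumes "m \<ge> 2"
  shows "int (thue_morse m (x * m ^ e + (m ^ e - 1))) = (int (thue_morse m x) - int e) mod int m"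
proof (induction e)
  case 0
  then show ?case using thue_morse_less[OF assms, of x] by simp
next
  case (Suc e)
  obtain c where c: "m ^ e = Suc c" using assms by (cases "m ^ e") auto
  obtain n where n: "m = Suc n" using assms by (cases m) auto
  have "x * m ^ Suc e + (m ^ Suc e - 1) = m * (x * m ^ e + (m ^ e - 1)) + (m - 1)"
    unfolding power_Suc c by (simp add: n algebra_simps)
  then have "thue_morse m (x * m ^ Suc e + (m ^ Suc e - 1))
      = (thue_morse m (x * m ^ e + (m ^ e - 1)) + (m - 1)) mod m"
    using assms by (simp only: thue_morse_rec)
  then have "int (thue_morse m (x * m ^ Suc e + (m ^ Suc e - 1)))
      = (int (thue_morse m (x * m ^ e + (m ^ e - 1))) + int (m - 1)) mod int m"
    by (simp only: zmod_int of_nat_add)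
  also have "\<dots> = ((int (thue_morse m x) - int e) mod int m + (int m - 1)) mod int m"
    using assms by (simp only: Suc of_nat_diff of_nat_1)
  also have "\<dots> = (int (thue_morse m x) - int e + (int m - 1)) mod int m"
    by (simp only: mod_add_left_eq)
  also have "int (thue_morse m x) - int e + (int m - 1) = int (thue_morse m x) - int (Suc e) + int m"
    by simp
  finally show ?case by (simp only: mod_add_self2)
qed

lemma thue_morse_01_10_factors:
  assumes "m \<ge> 2"
  shows "[0, 1] \<in> factors (thue_morse m)" "[1, 0] \<in> factors (thue_morse m)"
proof -
  have t1: "thue_morse m 1 = 1"
    using thue_morse_rec[OF assms, of 1 0] thue_morse_0[OF assms] assms by simp
  have "[0, 1] = map (thue_morse m) [0..<0 + 2]"
    using t1 thue_morse_0[OF assms] by (simp add: upt_rec numeral_2_eq_2)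
  then show "[0, 1] \<in> factors (thue_morse m)" by (simp only: map_upt_in_factors)
  have x: "thue_morse m (m * 1 + (m - 2)) = m - 1" "thue_morse m (m * 1 + (m - 1)) = 0"
    using assms t1 by (simp_all only: thue_morse_rec) simp_all
  \<comment> \<open>Base \<open>m\<close> digits \<open>1, m - 2, m - 1, \<dots>, m - 1\<close> with \<open>m - 2\<close> trailing digits \<open>m - 1\<close>: adding one
    carries through them.\<close>
  define p where "p = (m * 1 + (m - 2)) * m ^ (m - 2) + (m ^ (m - 2) - 1)"
  have "int (thue_morse m p) = 1"
    unfolding p_def thue_morse_trailing[OF assms] x using assms by simp
  then have 1: "thue_morse m p = 1" by simp
  \<comment> \<open>Appending zeros to the base-m expansion leaves the digit sum unchanged. This
    evaluates the position reached after the carry.\<close>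
  have iter: "thue_morse m (y * m ^ e) = thue_morse m y" for y e
  proof (induction e)
    case (Suc e)
    then show ?case
      using thue_morse_rec[OF assms, of 0 "y * m ^ e"] thue_morse_less[OF assms, of y] assms
      by (simp add: algebra_simps)
  qed simp
  obtain c where c: "m ^ (m - 2) = Suc c" using assms by (cases "m ^ (m - 2)") auto
  have "m * 1 + (m - 1) = Suc (m * 1 + (m - 2))" using assms by simp
  then have "Suc p = (m * 1 + (m - 1)) * m ^ (m - 2)" unfolding p_def c by simp
  then have "thue_morse m (Suc p) = 0" using iter x(2) by simp
  then have "[1, 0] = map (thue_morse m) [p..<p + 2]"
    using 1 by (simp add: upt_rec numeral_2_eq_2)
  then show "[1, 0] \<in> factors (thue_morse m)" by (simp only: map_upt_in_factors)
qed

section \<open>Existence of an equivalent pair of the critical length\<close>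

lemma ex_binomially_equivalent_factors:
  assumes "m \<ge> 2" "k \<ge> 1"
  shows "\<exists>u \<in> factors (thue_morse m). \<exists>v \<in> factors (thue_morse m).
     u \<noteq> v \<and> binomially_equivalent k u v \<and>
     length u = 2 * m ^ (k - 1) \<and> length v = 2 * m ^ (k - 1)"
proof -
  let ?s = "sigma m ^^ (k - 1)"
  have split: "?s [a, b] = ?s [a] @ ?s [b]" for a b
    using funpow_sigma_append[of "k - 1" m "[a]" "[b]"] by simp
  \<comment> \<open>The morphism preserves the first letter, so the two images begin with 0 and 1
    and are distinct.\<close>
  have first: "(sigma m ^^ j) (c # w) \<noteq> [] \<and> hd ((sigma m ^^ j) (c # w)) = c" if "c < m" for c j w
  proof (induction j)
    case (Suc j)
    then obtain w' where "(sigma m ^^ j) (c # w) = c # w'" by (cases "(sigma m ^^ j) (c # w)") auto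
    then have "(sigma m ^^ Suc j) (c # w) = sigma m (c # w')" by simp
    also have "\<dots> \<noteq> [] \<and> hd (sigma m (c # w')) = c"
      using that assms by (simp add: sigma_def upt_conv_Cons)
    finally show ?case by simp
  qed simp
  have "?s [0, 1] \<in> factors (thue_morse m)" "?s [1, 0] \<in> factors (thue_morse m)"
    using assms thue_morse_01_10_factors by (blast intro: funpow_sigma_factors)+
  moreover have "length (?s [0, 1]) = 2 * m ^ (k - 1)" "length (?s [1, 0]) = 2 * m ^ (k - 1)"
    by (simp_all add: length_funpow_sigma)
  moreover have "binomially_equivalent (Suc (k - 1)) (?s [0, 1]) (?s [1, 0])"
    unfolding split using assms
    by (intro binomially_equivalent_commute binomially_equivalent_funpow_sigma) auto
  moreover have "?s [0, 1] \<noteq> ?s [1, 0]"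
    using first[of 0 "k - 1" "[1]"] first[of 1 "k - 1" "[0]"] assms(1) by auto
  moreover have "Suc (k - 1) = k" using assms(2) by simp
  ultimately show ?thesis by (intro bexI[of _ "?s [0, 1]"] bexI[of _ "?s [1, 0]"]) simp_all
qed

section \<open>Moments\<close>

text \<open>The bound \<open>j < k\<close> matches level \<open>k\<close> of binomial equivalence:
  the order-j moment comes from subwords of at most j + 1 letters, of which only the last letter and
  its position are kept. Integer values allow negative shifts of the origin.\<close>

definition moments_agree :: "nat \<Rightarrow> nat \<Rightarrow> (nat \<Rightarrow> 'a) \<Rightarrow> (nat \<Rightarrow> 'a) \<Rightarrow> bool" where
  "moments_agree k n u v \<longleftrightarrow>
     (\<forall>j<k. \<forall>f :: 'a \<Rightarrow> int. (\<Sum>i<n. int i ^ j * (f (u i) - f (v i))) = 0)"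

lemma moments_agree_D:
  "moments_agree k n u v \<Longrightarrow> j < k \<Longrightarrow> (\<Sum>i<n. int i ^ j * (f (u i) - f (v i))) = 0"
  by (simp add: moments_agree_def)

lemma sum_shifted_power:
  fixes x d :: "'b \<Rightarrow> int"
  assumes "\<And>s. s \<le> j \<Longrightarrow> (\<Sum>i\<in>S. x i ^ s * d i) = 0"
  shows "(\<Sum>i\<in>S. (x i + c) ^ j * d i) = 0"
proof -
  have "(\<Sum>i\<in>S. (x i + c) ^ j * d i)
      = (\<Sum>i\<in>S. \<Sum>s\<le>j. of_nat (j choose s) * c ^ (j - s) * (x i ^ s * d i))"
    unfolding binomial_ring sum_distrib_right by (simp only: mult_ac)
  also have "\<dots> = (\<Sum>s\<le>j. of_nat (j choose s) * c ^ (j - s) * (\<Sum>i\<in>S. x i ^ s * d i))"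
    by (subst sum.swap) (simp add: sum_distrib_left)
  also have "\<dots> = 0" using assms by simp
  finally show ?thesis .
qed

text \<open>Moving the origin mixes the moment of order \<open>j\<close> only with those of lower
  order, which vanish too.\<close>

lemma moments_agree_shift:
  assumes "moments_agree k n u v" "j < k"
  shows "(\<Sum>i<n. (int i + c) ^ j * (f (u i) - f (v i))) = 0"
  using assms by (intro sum_shifted_power moments_agree_D) auto

lemma moments_agree_sym: "moments_agree k n u v \<Longrightarrow> moments_agree k n v u"
  by (simp add: moments_agree_def right_diff_distrib sum_subtractf)

lemma moments_agree_mono: "moments_agree k n u v \<Longrightarrow> j \<le> k \<Longrightarrow> moments_agree j n u v"
  by (simp add: moments_agree_def)

text \<open>Reversal is a change of sign of the index followed by a translation. The letter map
  \<open>g\<close> is absorbed into the test function; it later restores the increasing direction of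
  reversed blocks.\<close>

lemma moments_agree_reflect:
  assumes "moments_agree k n u v"
  shows "moments_agree k n (\<lambda>i. g (u (n - 1 - i))) (\<lambda>i. g (v (n - 1 - i)))"
  unfolding moments_agree_def
proof (intro allI impI)
  fix j and f :: "'b \<Rightarrow> int" assume j: "j < k"
  have "(\<Sum>i<n. int i ^ j * (f (g (u (n - 1 - i))) - f (g (v (n - 1 - i)))))
      = (\<Sum>i<n. int (n - 1 - i) ^ j * (f (g (u i)) - f (g (v i))))"
    by (rule sum.reindex_bij_witness[of _ "\<lambda>i. n - 1 - i" "\<lambda>i. n - 1 - i"]) auto
  also have "\<dots> = (\<Sum>i<n. (- 1) ^ j * ((int i + (1 - int n)) ^ j * (f (g (u i)) - f (g (v i)))))"
  proof (rule sum.cong)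
    fix i assume "i \<in> {..<n}"
    then have "int (n - 1 - i) = - 1 * (int i + (1 - int n))" by auto
    then show "int (n - 1 - i) ^ j * (f (g (u i)) - f (g (v i)))
        = (- 1) ^ j * ((int i + (1 - int n)) ^ j * (f (g (u i)) - f (g (v i))))"
      by (simp only: power_mult_distrib mult.assoc)
  qed simp
  also have "\<dots> = 0"
    unfolding sum_distrib_left[symmetric]
    using moments_agree_shift[OF assms j, of _ "\<lambda>x. f (g x)"] by simp
  finally show "(\<Sum>i<n. int i ^ j * (f (g (u (n - 1 - i))) - f (g (v (n - 1 - i))))) = 0" .
qed

lemma moments_agree_trim:
  assumes "moments_agree k n u v" "a + l \<le> n"
    and "\<And>i. i < n \<Longrightarrow> i < a \<or> i \<ge> a + l \<Longrightarrow> u i = v i"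
  shows "moments_agree k l (\<lambda>i. u (a + i)) (\<lambda>i. v (a + i))"
  unfolding moments_agree_def
proof (intro allI impI)
  fix j and f :: "'a \<Rightarrow> int" assume j: "j < k"
  have "0 = (\<Sum>i<n. (int i + (- int a)) ^ j * (f (u i) - f (v i)))"
    by (rule moments_agree_shift[OF assms(1) j, symmetric])
  also have "\<dots> = (\<Sum>i\<in>{a..<a + l}. (int i + (- int a)) ^ j * (f (u i) - f (v i)))"
    using assms(2,3) by (intro sum.mono_neutral_right) force+
  also have "\<dots> = (\<Sum>i<l. int i ^ j * (f (u (a + i)) - f (v (a + i))))"
    by (rule sum.reindex_bij_witness[of _ "\<lambda>i. a + i" "\<lambda>i. i - a"]) auto
  finally show "(\<Sum>i<l. int i ^ j * (f (u (a + i)) - f (v (a + i)))) = 0" by simp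
qed

section \<open>From binomial coefficients to moments\<close>

lemma words_Suc_eq_image:
  "{x. set x \<subseteq> A \<and> length x = Suc j} = (\<lambda>(x, a). x @ [a]) ` ({x. set x \<subseteq> A \<and> length x = j} \<times> A)"
proof (intro equalityI subsetI)
  fix x assume x: "x \<in> {x. set x \<subseteq> A \<and> length x = Suc j}"
  then have "x \<noteq> []" by auto
  then have "x = butlast x @ [last x]" by simp
  moreover have "set (butlast x) \<subseteq> A" "length (butlast x) = j" "last x \<in> A"
    using x \<open>x \<noteq> []\<close> by (auto dest: in_set_butlastD)
  ultimately show "x \<in> (\<lambda>(x, a). x @ [a]) ` ({x. set x \<subseteq> A \<and> length x = j} \<times> A)"
    by force
qed auto

lemma sum_words_Suc:
  assumes "finite A"
  shows "(\<Sum>x | set x \<subseteq> A \<and> length x = Suc j. g x)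
       = (\<Sum>x | set x \<subseteq> A \<and> length x = j. \<Sum>a\<in>A. g (x @ [a]))"
  unfolding words_Suc_eq_image
  by (subst sum.reindex) (auto simp: inj_on_def sum.cartesian_product comp_def intro!: sum.cong)

text \<open>Summing over all words of length \<open>j\<close> forgets the letters, so every j-subset
  of positions is counted once.\<close>

lemma sum_word_binomial:
  assumes "finite A" "set u \<subseteq> A"
  shows "(\<Sum>x | set x \<subseteq> A \<and> length x = j. word_binomial u x) = length u choose j"
  using assms(2)
proof (induction u arbitrary: j rule: rev_induct)
  case Nil
  show ?case
  proof (cases j)
    case 0
    then have "{x. set x \<subseteq> A \<and> length x = j} = {[]}" by auto
    then show ?thesis by (simp add: 0)
  next
    case (Suc i)
    then show ?thesis by (auto simp: word_binomial_Nil_left intro!: sum.neutral)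
  qed
next
  case (snoc b u)
  show ?case
  proof (cases j)
    case 0
    then have "{x. set x \<subseteq> A \<and> length x = j} = {[]}" by auto
    then show ?thesis by (simp add: 0)
  next
    case (Suc i)
    have "(\<Sum>x | set x \<subseteq> A \<and> length x = j. word_binomial (u @ [b]) x)
        = (\<Sum>x | set x \<subseteq> A \<and> length x = i. \<Sum>a\<in>A. word_binomial u (x @ [a]))
          + (\<Sum>x | set x \<subseteq> A \<and> length x = i. \<Sum>a\<in>A. of_bool (a = b) * word_binomial u x)"
      by (simp add: Suc sum_words_Suc[OF assms(1)] word_binomial_snoc sum.distrib)
    also have "(\<Sum>x | set x \<subseteq> A \<and> length x = i. \<Sum>a\<in>A. word_binomial u (x @ [a]))
        = length u choose Suc i"
      using snoc by (simp add: sum_words_Suc[OF assms(1), symmetric])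
    also have "(\<Sum>x | set x \<subseteq> A \<and> length x = i. \<Sum>a\<in>A. of_bool (a = b) * word_binomial u x)
        = length u choose i"
      using snoc assms(1) by (simp add: sum_distrib_right[symmetric])
    finally show ?thesis by (simp add: Suc)
  qed
qed

text \<open>Sort the occurrences by the position \<open>i\<close> of the final \<open>a\<close>: the
  other letters are free, so their positions form any j-subset of the \<open>i\<close> earlier ones.
  This is a moment with weight \<open>i choose j\<close>.\<close>

lemma sum_word_binomial_snoc:
  assumes "finite A" "set u \<subseteq> A"
  shows "(\<Sum>x | set x \<subseteq> A \<and> length x = j. word_binomial u (x @ [a]))
       = (\<Sum>i<length u. (i choose j) * of_bool (u ! i = a))"
  using assms(2)
proof (induction u rule: rev_induct)
  case Nil
  show ?case by (simp add: word_binomial_Nil_left)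
next
  case (snoc b u)
  have "(\<Sum>x | set x \<subseteq> A \<and> length x = j. word_binomial (u @ [b]) (x @ [a]))
      = (\<Sum>i<length u. (i choose j) * of_bool (u ! i = a)) + (length u choose j) * of_bool (b = a)"
    using snoc sum_word_binomial[OF assms(1), of u j]
    by (auto simp: word_binomial_snoc sum.distrib)
  then show ?case by (simp add: nth_append)
qed

lemma binomially_equivalent_length:
  assumes "binomially_equivalent k u v" "k \<ge> 1"
  shows "length u = length v"
proof -
  let ?A = "set u \<union> set v"
  have "length u = (\<Sum>x | set x \<subseteq> ?A \<and> length x = 1. word_binomial u x)"
    by (subst sum_word_binomial) auto
  also have "\<dots> = (\<Sum>x | set x \<subseteq> ?A \<and> length x = 1. word_binomial v x)"
    using assms by (intro sum.cong) (auto simp: binomially_equivalent_def)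
  also have "\<dots> = length v"
    by (subst sum_word_binomial) auto
  finally show ?thesis .
qed

text \<open>The recursion for passing from the weights \<open>i choose s\<close> to the powers of
  \<open>i\<close>.\<close>

lemma of_nat_mult_binomial:
  "int i * int (i choose s) = int (Suc s) * int (i choose Suc s) + int s * int (i choose s)"
proof -
  have "Suc s * (i choose Suc s) + s * (i choose s) = i * (i choose s)"
  proof (cases "s \<le> i")
    case True
    have "Suc s * (i choose Suc s) = (i - s) * (i choose s)"
      using True by (metis binomial_absorb_comp binomial_absorption)
    then show ?thesis using True by (simp add: add_mult_distrib[symmetric])
  qed (simp add: binomial_eq_0)
  then show ?thesis by (metis of_nat_add of_nat_mult)
qed

lemma binomially_equivalent_moments_agree:
  assumes "binomially_equivalent k u v" "length u = n" "length v = n"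
  shows "moments_agree k n (\<lambda>i. u ! i) (\<lambda>i. v ! i)"
  unfolding moments_agree_def
proof (intro allI impI)
  fix j and f :: "'a \<Rightarrow> int" assume "j < k"
  let ?A = "set u \<union> set v"
  let ?d = "\<lambda>i. f (u ! i) - f (v ! i)"
  have single: "(\<Sum>i<n. int (i choose s) * of_bool (u ! i = a))
      = (\<Sum>i<n. int (i choose s) * of_bool (v ! i = a))" if "s < k" for s a
  proof -
    have "(\<Sum>i<n. (i choose s) * of_bool (u ! i = a))
        = (\<Sum>x | set x \<subseteq> ?A \<and> length x = s. word_binomial u (x @ [a]))"
      unfolding assms(2)[symmetric] by (rule sum_word_binomial_snoc[symmetric]) auto
    also have "\<dots> = (\<Sum>x | set x \<subseteq> ?A \<and> length x = s. word_binomial v (x @ [a]))"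
      using assms(1) that by (intro sum.cong) (auto simp: binomially_equivalent_def)
    also have "\<dots> = (\<Sum>i<n. (i choose s) * of_bool (v ! i = a))"
      unfolding assms(3)[symmetric] by (rule sum_word_binomial_snoc) auto
    finally show ?thesis
      by (metis (mono_tags, lifting) of_nat_mult of_nat_of_bool of_nat_sum sum.cong)
  qed
  \<comment> \<open>An arbitrary test function is a combination of indicators of the letters that
    occur.\<close>
  have expand: "(\<Sum>i<n. int (i choose s) * f (w ! i))
      = (\<Sum>a\<in>?A. f a * (\<Sum>i<n. int (i choose s) * of_bool (w ! i = a)))"
    if "length w = n" "set w \<subseteq> ?A" for w s
  proof -
    have *: "f (w ! i) = (\<Sum>a\<in>?A. f a * of_bool (w ! i = a))" if "i < n" for i
    proof -
      have "w ! i \<in> set w" using \<open>length w = n\<close> that by simp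
      then have "w ! i \<in> ?A" using \<open>set w \<subseteq> ?A\<close> by blast
      then have "(\<Sum>a\<in>?A. f a * of_bool (w ! i = a)) = (\<Sum>a\<in>{w ! i}. f a * of_bool (w ! i = a))"
        by (intro sum.mono_neutral_right) auto
      then show ?thesis by simp
    qed
    have "(\<Sum>i<n. int (i choose s) * f (w ! i))
        = (\<Sum>i<n. \<Sum>a\<in>?A. f a * (int (i choose s) * of_bool (w ! i = a)))"
    proof (intro sum.cong refl)
      fix i assume "i \<in> {..<n}"
      then have "int (i choose s) * f (w ! i) = int (i choose s) * (\<Sum>a\<in>?A. f a * of_bool (w ! i = a))"
        using * by (metis lessThan_iff)
      then show "int (i choose s) * f (w ! i) = (\<Sum>a\<in>?A. f a * (int (i choose s) * of_bool (w ! i = a)))"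
        by (simp only: sum_distrib_left mult.left_commute)
    qed
    also have "\<dots> = (\<Sum>a\<in>?A. f a * (\<Sum>i<n. int (i choose s) * of_bool (w ! i = a)))"
      by (subst sum.swap) (simp only: sum_distrib_left)
    finally show ?thesis .
  qed
  \<comment> \<open>Mixed weights make the induction work: one factor \<open>i\<close> is traded for
    a binomial weight with \<open>s\<close> or \<open>s + 1\<close>, and \<open>s + e\<close> stays
    below \<open>k\<close>.\<close>
  have "(\<Sum>i<n. int (i choose s) * int i ^ e * ?d i) = 0" if "s + e < k" for s e
    using that
  proof (induction e arbitrary: s)
    case 0
    then show ?case
      using expand[of u s] expand[of v s] assms(2,3) single[of s]
      by (simp add: right_diff_distrib sum_subtractf)
  next
    case (Suc e)
    have "(\<Sum>i<n. int (i choose s) * int i ^ Suc e * ?d i)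
        = (\<Sum>i<n. int (Suc s) * (int (i choose Suc s) * int i ^ e * ?d i)
                 + int s * (int (i choose s) * int i ^ e * ?d i))"
    proof (rule sum.cong)
      fix i
      have "int (i choose s) * int i ^ Suc e * ?d i = (int i * int (i choose s)) * (int i ^ e * ?d i)"
        by (simp add: mult_ac)
      also have "\<dots> = int (Suc s) * (int (i choose Suc s) * int i ^ e * ?d i)
                 + int s * (int (i choose s) * int i ^ e * ?d i)"
        unfolding of_nat_mult_binomial by (simp only: distrib_right mult.assoc)
      finally show "int (i choose s) * int i ^ Suc e * ?d i = \<dots>" .
    qed simp
    also have "\<dots> = 0"
      unfolding sum.distrib sum_distrib_left[symmetric] using Suc.IH[of "Suc s"] Suc.IH[of s] Suc.prems
      by simp
    finally show ?case .
  qed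
  from this[of 0 j] show "(\<Sum>i<n. int i ^ j * ?d i) = 0" using \<open>j < k\<close> by simp
qed

section \<open>Aligning with the block structure\<close>

text \<open>In a word \<open>u\<close> cut out of a concatenation of blocks \<open>b (b + 1) \<dots> (b + m - 1)\<close>, the
  following sum telescopes inside every block. Only block boundaries and the right end of \<open>u\<close>
  contribute.\<close>

definition boundary_sum :: "int \<Rightarrow> int \<Rightarrow> (nat \<Rightarrow> int) \<Rightarrow> nat \<Rightarrow> int" where
  "boundary_sum m c u n =
     (\<Sum>i<n. (int i + 1) * of_bool ((u i + 1) mod m = c) - int i * of_bool (u i = c))"

text \<open>Here \<open>s\<close> counts the positions of the last block up to index n - 1, so
  \<open>max 0 (int n - s)\<close> is where that block starts inside the word. A boundary at
  \<open>i\<close> contributes \<open>i\<close> times the indicator that the old block starts with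
  \<open>c\<close>, minus the same for the new block. By summation by parts, \<open>P\<close> is the
  total length inside the word of the earlier blocks whose first letter is \<open>c\<close>.\<close>

lemma boundary_sum_eq:
  fixes m r :: int and y :: "int \<Rightarrow> int" and u :: "nat \<Rightarrow> int"
  assumes "m > 0" "n \<ge> 1"
    and u: "\<And>i. i < n \<Longrightarrow> u i = (y ((r + int i) div m) + (r + int i)) mod m"
  defines "s \<equiv> (r + int n - 1) mod m + 1"
  shows "\<exists>P. 0 \<le> P \<and> P \<le> max 0 (int n - s) \<and>
     boundary_sum m c u n = int n * of_bool ((u (n - 1) + 1) mod m = c)
       - max 0 (int n - s) * of_bool (y ((r + int n - 1) div m) mod m = c) + P"
  using assms(2) u unfolding s_def
proof (induction n rule: nat_induct_at_least)
  case base
  show ?case using assms(1) by (auto simp: boundary_sum_def)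
next
  case (Suc n)
  define p where "p = r + int n - 1"
  define q where "q = max 0 (int n - (p mod m + 1))"
  let ?b = "y (p div m) mod m" and ?z = "(u (n - 1) + 1) mod m"
  obtain P where P: "0 \<le> P" "P \<le> q"
    "boundary_sum m c u n = int n * of_bool (?z = c) - q * of_bool (?b = c) + P"
    using Suc.IH Suc.prems unfolding p_def q_def by (metis less_SucI)
  have step: "boundary_sum m c u (Suc n) = boundary_sum m c u n
      + (int n + 1) * of_bool ((u n + 1) mod m = c) - int n * of_bool (u n = c)"
    by (simp add: boundary_sum_def)
  have un1: "u (n - 1) = (y (p div m) + p) mod m"
  proof -
    have "r + int (n - 1) = p" using Suc.hyps by (simp add: p_def)
    then show ?thesis using Suc.prems[of "n - 1"] by simp
  qed
  have un: "u n = (y ((p + 1) div m) + (p + 1)) mod m"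
    using Suc.prems[of n] by (simp add: p_def)
  have p_Suc: "r + int (Suc n) - 1 = p + 1" by (simp add: p_def)
  have z: "?z = (y (p div m) + (p + 1)) mod m"
    unfolding un1 by (simp add: mod_add_left_eq add.assoc)
  show ?case
  proof (cases "p mod m = m - 1")
    case False
    have "0 \<le> p mod m" "p mod m < m" using assms(1) by simp_all
    with False have "p mod m + 1 < m" by linarith
    moreover have "p + 1 = m * (p div m) + (p mod m + 1)" by simp
    ultimately have dm: "(p + 1) div m = p div m" "(p + 1) mod m = p mod m + 1"
      using \<open>0 \<le> p mod m\<close> by (blast intro: int_div_pos_eq int_mod_pos_eq add_nonneg_nonneg zero_le_one)+
    have "u n = ?z" using un dm(1) z by simp
    then show ?thesis
      unfolding p_Suc dm step P(3) using P(1,2) q_def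
      by (intro exI[of _ P]) (auto simp: algebra_simps)
  next
    case True
    have "p + 1 = m * (p div m) + (p mod m + 1)" by simp
    then have "p + 1 = m * (p div m + 1)" using True by (simp only: distrib_left mult_1_right)
    then have dvd: "(p + 1) mod m = 0" by simp
    have "?z = ?b" unfolding z using dvd by (metis mod_add_right_eq add_0_right)
    moreover have "u n = y ((p + 1) div m) mod m" unfolding un using dvd by (metis mod_add_right_eq add_0_right)
    moreover have "q \<le> int n" "q \<ge> 0" using assms(1) True by (auto simp: q_def)
    ultimately show ?thesis
      unfolding p_Suc dvd step P(3) using P(1,2)
      \<comment> \<open>The block just completed occupies \<open>n - q\<close> positions of the word
        and joins \<open>P\<close> if it starts with \<open>c\<close>.\<close>
      by (intro exI[of _ "P + (int n - q) * of_bool (?b = c)"]) (auto simp: algebra_simps)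
  qed
qed

lemma boundary_sum_moments_agree:
  assumes "moments_agree 2 n u v"
  shows "boundary_sum m c u n = boundary_sum m c v n"
proof -
  let ?f = "\<lambda>x. of_bool ((x + 1) mod m = c) :: int" and ?g = "\<lambda>x. of_bool (x = c) :: int"
  have "boundary_sum m c u n - boundary_sum m c v n
      = (\<Sum>i<n. (int i + 1) ^ 1 * (?f (u i) - ?f (v i))) - (\<Sum>i<n. int i ^ 1 * (?g (u i) - ?g (v i)))"
    by (simp add: boundary_sum_def sum_subtractf[symmetric] algebra_simps)
  also have "\<dots> = 0"
    using moments_agree_shift[OF assms, of 1 1 ?f] moments_agree_D[OF assms, of 1 ?g] by simp
  finally show ?thesis by simp
qed

text \<open>Compare boundary sums for the letter \<open>c\<close> that cyclically follows the last
  letter of \<open>v\<close>. If \<open>v\<close> stopped inside a block, its sum would be at least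
  \<open>n\<close>, while that of \<open>u\<close> is smaller.\<close>

lemma right_end_aligned:
  fixes m r r' :: int and y y' :: "int \<Rightarrow> int" and u v :: "nat \<Rightarrow> int"
  assumes "m > 0" "n \<ge> 1"
    and u: "\<And>i. i < n \<Longrightarrow> u i = (y ((r + int i) div m) + (r + int i)) mod m"
    and v: "\<And>i. i < n \<Longrightarrow> v i = (y' ((r' + int i) div m) + (r' + int i)) mod m"
    and "moments_agree 2 n u v" "u (n - 1) \<noteq> v (n - 1)"
  shows "m dvd r' + int n"
proof (rule ccontr)
  assume ndvd: "\<not> m dvd r' + int n"
  define c where "c = (v (n - 1) + 1) mod m"
  define p where "p = r' + int n - 1"
  have range: "0 \<le> u (n - 1)" "u (n - 1) < m" "0 \<le> v (n - 1)" "v (n - 1) < m"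
    using u[of "n - 1"] v[of "n - 1"] assms(1,2) by simp_all
  have "(u (n - 1) + 1) mod m \<noteq> c"
  proof
    assume "(u (n - 1) + 1) mod m = c"
    then have "(u (n - 1) + 1 - 1) mod m = (v (n - 1) + 1 - 1) mod m"
      unfolding c_def by (metis mod_diff_left_eq)
    then show False using range assms(6) by simp
  qed
  moreover obtain P where "0 \<le> P" "P \<le> max 0 (int n - ((r + int n - 1) mod m + 1))"
     "boundary_sum m c u n = int n * of_bool ((u (n - 1) + 1) mod m = c)
       - max 0 (int n - ((r + int n - 1) mod m + 1)) * of_bool (y ((r + int n - 1) div m) mod m = c) + P"
    using boundary_sum_eq[OF assms(1,2) u] by blast
  moreover have "0 \<le> (r + int n - 1) mod m" using assms(1) by simp
  \<comment> \<open>The end term vanishes for \<open>u\<close>, leaving at most \<open>P\<close>;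
    the last block covers at least one position, so \<open>P < n\<close>.\<close>
  ultimately have "boundary_sum m c u n < int n"
    using assms(2) by (auto split: if_splits simp: max_def of_bool_def)
  moreover have "boundary_sum m c v n \<ge> int n"
  proof -
    obtain Q where "0 \<le> Q" "boundary_sum m c v n = int n * of_bool ((v (n - 1) + 1) mod m = c)
       - max 0 (int n - (p mod m + 1)) * of_bool (y' (p div m) mod m = c) + Q"
      using boundary_sum_eq[OF assms(1,2) v] unfolding p_def by blast
    \<comment> \<open>The successor of the last letter equals the first letter of its block only at
      the end of the block. Hence the negative term vanishes for \<open>v\<close>.\<close>
    moreover have "y' (p div m) mod m \<noteq> c"
    proof
      assume *: "y' (p div m) mod m = c"
      have "r' + int (n - 1) = p" using assms(2) by (simp add: p_def)
      then have "c = (y' (p div m) + (p + 1)) mod m"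
        unfolding c_def using v[of "n - 1"] assms(2) by (simp add: mod_add_left_eq add.assoc)
      then have "m dvd (y' (p div m) + (p + 1)) - y' (p div m)"
        using * by (metis mod_eq_dvd_iff)
      then show False using ndvd by (simp add: p_def)
    qed
    ultimately show ?thesis by (simp add: c_def)
  qed
  ultimately show False using boundary_sum_moments_agree[OF assms(5), of m c] by simp
qed

text \<open>Reversal turns blocks into decreasing runs, and the letter map x to -1 - x makes them
  increasing again. The right-end result then applies to the reflected words.\<close>

lemma left_end_aligned:
  fixes m r r' :: int and y y' :: "int \<Rightarrow> int" and u v :: "nat \<Rightarrow> int"
  assumes "m > 0" "n \<ge> 1"
    and u: "\<And>i. i < n \<Longrightarrow> u i = (y ((r + int i) div m) + (r + int i)) mod m"
    and v: "\<And>i. i < n \<Longrightarrow> v i = (y' ((r' + int i) div m) + (r' + int i)) mod m"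
    and "moments_agree 2 n u v" "u 0 \<noteq> v 0"
  shows "m dvd r'"
proof -
  define R where "R w i = (- 1 - w (n - 1 - i)) mod m" for w :: "nat \<Rightarrow> int" and i
  have reflect: "R w i = (- Y (- 1 - (- R' - int n + int i) div m) + (- R' - int n + int i)) mod m"
    if w: "\<And>i. i < n \<Longrightarrow> w i = (Y ((R' + int i) div m) + (R' + int i)) mod m" and i: "i < n"
    for w Y R' i
  proof -
    define p where "p = - R' - int n + int i"
    have e: "R' + int (n - 1 - i) = - 1 - p" using i by (simp add: p_def)
    \<comment> \<open>The reflection p to -1 - p carries each interval from \<open>m * q\<close> to
      \<open>m * q + m - 1\<close> onto another such interval, so floor division commutes with
      it.\<close>
    have dv: "(- 1 - p) div m = - 1 - p div m"
    proof -
      have "- 1 - p = m * (- 1 - p div m) + (m - 1 - p mod m)"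
        using mult_div_mod_eq[of m p] by (simp add: algebra_simps)
      moreover have "p mod m < m" "0 \<le> p mod m" using assms(1) by simp_all
      ultimately show ?thesis by (intro int_div_pos_eq[of _ _ _ "m - 1 - p mod m"]) auto
    qed
    have "w (n - 1 - i) = (Y (- 1 - p div m) + (- 1 - p)) mod m"
      using w[of "n - 1 - i"] i unfolding e dv by simp
    then have "R w i = (- 1 - (Y (- 1 - p div m) + (- 1 - p))) mod m"
      by (simp only: R_def mod_diff_right_eq)
    then show ?thesis unfolding p_def[symmetric] by (simp add: algebra_simps)
  qed
  have range: "0 \<le> u 0" "u 0 < m" "0 \<le> v 0" "v 0 < m"
    using u[of 0] v[of 0] assms(1,2) by simp_all
  have "R u (n - 1) \<noteq> R v (n - 1)"
  proof
    assume "R u (n - 1) = R v (n - 1)"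
    then have "(- 1 - u 0) mod m = (- 1 - v 0) mod m" by (simp add: R_def)
    then have "(- 1 - (- 1 - u 0)) mod m = (- 1 - (- 1 - v 0)) mod m" by (metis mod_diff_right_eq)
    then show False using range assms(6) by simp
  qed
  moreover have "moments_agree 2 n (R u) (R v)"
    unfolding R_def by (rule moments_agree_reflect[OF assms(5), of "\<lambda>x. (- 1 - x) mod m"])
  ultimately have "m dvd (- r' - int n) + int n"
    by (intro right_end_aligned[OF assms(1,2) reflect[OF u] reflect[OF v]])
  then show ?thesis by simp
qed

section \<open>Desubstitution\<close>

lemma sum_lessThan_add:
  fixes g :: "nat \<Rightarrow> 'b::comm_monoid_add"
  shows "(\<Sum>i<a + m. g i) = (\<Sum>i<a. g i) + (\<Sum>s<m. g (a + s))"
  by (induction m) (simp_all add: add.assoc)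

lemma sum_blocks:
  fixes g :: "nat \<Rightarrow> 'b::comm_monoid_add"
  shows "(\<Sum>i<m * l. g i) = (\<Sum>q<l. \<Sum>s<m. g (m * q + s))"
proof (induction l)
  case (Suc l)
  have "(\<Sum>i<m * l + m. g i) = (\<Sum>i<m * l. g i) + (\<Sum>s<m. g (m * l + s))"
    by (rule sum_lessThan_add)
  then show ?case using Suc by (simp add: add.commute)
qed simp

text \<open>Weights \<open>i ^ e\<close> telescope within a block to
  \<open>m ^ e * ((q + 1) ^ e - q ^ e)\<close> at its first letter. This polynomial in
  \<open>q\<close> has degree e - 1, which costs one order of moments.\<close>

lemma moments_agree_desubstitute:
  fixes u v w w' :: "nat \<Rightarrow> int" and m :: nat
  assumes "m > 0" "moments_agree (Suc k) (m * l) u v"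
    and u: "\<And>q s. q < l \<Longrightarrow> s < m \<Longrightarrow> u (m * q + s) = (w q + int s) mod int m"
    and v: "\<And>q s. q < l \<Longrightarrow> s < m \<Longrightarrow> v (m * q + s) = (w' q + int s) mod int m"
    and w: "\<And>q. q < l \<Longrightarrow> w q mod int m = w q" "\<And>q. q < l \<Longrightarrow> w' q mod int m = w' q"
  shows "moments_agree k l w w'"
proof -
  have telescope: "(\<Sum>i<m * l. (int i + 1) ^ e * f ((x i + 1) mod int m) - int i ^ e * f (x i))
      = int m ^ e * (\<Sum>q<l. ((int q + 1) ^ e - int q ^ e) * f (z q))"
    if x: "\<And>q s. q < l \<Longrightarrow> s < m \<Longrightarrow> x (m * q + s) = (z q + int s) mod int m"
      and z: "\<And>q. q < l \<Longrightarrow> z q mod int m = z q"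
    for x z e and f :: "int \<Rightarrow> int"
  proof -
    have "(\<Sum>s<m. (int (m * q + s) + 1) ^ e * f ((x (m * q + s) + 1) mod int m)
              - int (m * q + s) ^ e * f (x (m * q + s)))
        = int m ^ e * (((int q + 1) ^ e - int q ^ e) * f (z q))" if q: "q < l" for q
    proof -
      define h where "h s = int (m * q + s) ^ e * f ((z q + int s) mod int m)" for s
      have "(\<Sum>s<m. (int (m * q + s) + 1) ^ e * f ((x (m * q + s) + 1) mod int m)
              - int (m * q + s) ^ e * f (x (m * q + s))) = (\<Sum>s<m. h (Suc s) - h s)"
      proof (rule sum.cong)
        fix s assume "s \<in> {..<m}"
        then have "x (m * q + s) = (z q + int s) mod int m" using x q by simp
        moreover from this have "(x (m * q + s) + 1) mod int m = (z q + int (Suc s)) mod int m"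
          by (simp add: mod_add_left_eq add.assoc add.commute[of 1])
        ultimately show "(int (m * q + s) + 1) ^ e * f ((x (m * q + s) + 1) mod int m)
              - int (m * q + s) ^ e * f (x (m * q + s)) = h (Suc s) - h s"
          by (simp add: h_def add_ac)
      qed simp
      also have "\<dots> = h m - h 0" by (rule sum_lessThan_telescope)
      also have "\<dots> = (int m * (int q + 1)) ^ e * f (z q) - (int m * int q) ^ e * f (z q)"
        using z[OF q] by (simp add: h_def algebra_simps)
      finally show ?thesis by (simp only: power_mult_distrib left_diff_distrib right_diff_distrib mult.assoc)
    qed
    then show ?thesis by (simp add: sum_blocks sum_distrib_left)
  qed
  have differences: "(\<Sum>q<l. ((int q + 1) ^ e - int q ^ e) * (f (w q) - f (w' q))) = 0"
    if "e < Suc k" for e and f :: "int \<Rightarrow> int"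
  proof -
    have "int m ^ e * (\<Sum>q<l. ((int q + 1) ^ e - int q ^ e) * (f (w q) - f (w' q)))
        = int m ^ e * (\<Sum>q<l. ((int q + 1) ^ e - int q ^ e) * f (w q))
          - int m ^ e * (\<Sum>q<l. ((int q + 1) ^ e - int q ^ e) * f (w' q))"
      by (simp add: right_diff_distrib sum_subtractf)
    also have "\<dots> = (\<Sum>i<m * l. (int i + 1) ^ e * f ((u i + 1) mod int m) - int i ^ e * f (u i))
        - (\<Sum>i<m * l. (int i + 1) ^ e * f ((v i + 1) mod int m) - int i ^ e * f (v i))"
      using telescope[of u w e f] telescope[of v w' e f] u v w by simp
    also have "\<dots> = (\<Sum>i<m * l. (int i + 1) ^ e * (f ((u i + 1) mod int m) - f ((v i + 1) mod int m)))
        - (\<Sum>i<m * l. int i ^ e * (f (u i) - f (v i)))"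
      by (simp add: sum_subtractf[symmetric] algebra_simps)
    also have "\<dots> = 0"
      using moments_agree_shift[OF assms(2) that, of 1 "\<lambda>x. f ((x + 1) mod int m)"]
        moments_agree_D[OF assms(2) that, of f] by simp
    finally show ?thesis using assms(1) by simp
  qed
  show ?thesis unfolding moments_agree_def
  proof (intro allI impI)
    fix j and f :: "int \<Rightarrow> int"
    assume "j < k"
    then show "(\<Sum>q<l. int q ^ j * (f (w q) - f (w' q))) = 0"
    proof (induction j rule: less_induct)
      case (less j)
      let ?d = "\<lambda>q. f (w q) - f (w' q)"
      \<comment> \<open>The leading term isolates the moment of order \<open>j\<close>; the
        remaining ones have lower order and vanish by induction.\<close>
      have expand: "(x + 1) ^ Suc j - x ^ Suc j
          = (\<Sum>s<j. int (Suc j choose s) * x ^ s) + int (Suc j) * x ^ j" for x :: int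
      proof -
        have "(x + 1) ^ Suc j = (\<Sum>s\<le>Suc j. int (Suc j choose s) * x ^ s)"
          by (simp only: binomial_ring power_one mult_1_right)
        also have "\<dots> = (\<Sum>s<j. int (Suc j choose s) * x ^ s) + int (Suc j) * x ^ j + x ^ Suc j"
          by (simp add: lessThan_Suc_atMost[symmetric] del: binomial_Suc_Suc)
        finally show ?thesis by simp
      qed
      have "0 = (\<Sum>q<l. ((int q + 1) ^ Suc j - int q ^ Suc j) * ?d q)"
        using differences[of "Suc j" f] less.prems by simp
      also have "\<dots> = (\<Sum>q<l. \<Sum>s<j. int (Suc j choose s) * (int q ^ s * ?d q))
          + (\<Sum>q<l. int (Suc j) * (int q ^ j * ?d q))"
        unfolding expand distrib_right sum.distrib sum_distrib_right by (simp only: mult.assoc)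
      also have "(\<Sum>q<l. \<Sum>s<j. int (Suc j choose s) * (int q ^ s * ?d q))
          = (\<Sum>s<j. int (Suc j choose s) * (\<Sum>q<l. int q ^ s * ?d q))"
        by (subst sum.swap) (simp only: sum_distrib_left)
      also have "\<dots> = 0" using less by (intro sum.neutral) simp
      finally have "int (Suc j) * (\<Sum>q<l. int q ^ j * ?d q) = 0" by (simp only: sum_distrib_left add_0)
      then show ?case by (simp del: of_nat_Suc)
    qed
  qed
qed

section \<open>Lower bound on the length\<close>

text \<open>Brings a factor starting at \<open>i\<close> into the form required by the alignment
  lemmas, with offset \<open>int i\<close>. The block index is nonnegative here, so
  \<open>nat\<close> loses nothing.\<close>

lemma thue_morse_block:
  assumes "m \<ge> 2"
  shows "int (thue_morse m (i + n))
    = (int (thue_morse m (nat ((int i + int n) div int m))) + (int i + int n)) mod int m"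
proof -
  have "thue_morse m (m * ((i + n) div m) + (i + n) mod m) = (thue_morse m ((i + n) div m) + (i + n) mod m) mod m"
    using assms by (intro thue_morse_rec) auto
  then have "thue_morse m (i + n) = (thue_morse m ((i + n) div m) + (i + n)) mod m"
    by (simp add: mod_add_right_eq)
  moreover have "nat ((int i + int n) div int m) = (i + n) div m"
    by (metis of_nat_add zdiv_int nat_int)
  ultimately show ?thesis by (simp add: zmod_int)
qed

lemma moments_agree_thue_morse_length:
  assumes "m \<ge> 2" "k \<ge> 1"
    and "moments_agree k n (\<lambda>i. int (thue_morse m (a + i))) (\<lambda>i. int (thue_morse m (b + i)))"
    and "\<exists>i<n. thue_morse m (a + i) \<noteq> thue_morse m (b + i)"
  shows "n \<ge> 2 * m ^ (k - 1)"
  using assms(2-)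
proof (induction k arbitrary: n a b rule: nat_induct_at_least)
  case base
  let ?t = "\<lambda>i. int (thue_morse m i)"
  show ?case
  proof (rule ccontr)
    assume "\<not> 2 * m ^ (1 - 1) \<le> n"
    moreover obtain i where i: "i < n" "thue_morse m (a + i) \<noteq> thue_morse m (b + i)"
      using base.prems(2) by blast
    ultimately have n: "n = 1" by simp
    then have ne: "?t a \<noteq> ?t b" using i by simp
    show False
      using moments_agree_D[OF base.prems(1), of 0 "\<lambda>x. of_bool (x = ?t a)"] ne by (simp add: n)
  qed
next
  case (Suc k)
  let ?t = "\<lambda>i. int (thue_morse m i)"
  let ?D = "{i. i < n \<and> thue_morse m (a + i) \<noteq> thue_morse m (b + i)}"
  have D: "finite ?D" "?D \<noteq> {}" using Suc.prems(2) by auto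
  \<comment> \<open>The first and last disagreements; cutting there makes the words differ at both
    ends.\<close>
  define lo hi where "lo = Min ?D" and "hi = Max ?D"
  have lo: "lo \<in> ?D" and hi: "hi \<in> ?D"
    unfolding lo_def hi_def by (rule Min_in[OF D], rule Max_in[OF D])
  have out: "i \<notin> ?D" if "i < lo \<or> i > hi" for i
    using that Min_le[OF D(1), of i] Max_ge[OF D(1), of i] unfolding lo_def hi_def by linarith
  have "lo \<le> hi" unfolding lo_def using hi D by simp
  define N where "N = hi + 1 - lo"
  define a' b' where "a' = a + lo" and "b' = b + lo"
  have N: "N \<ge> 1" "lo + N = hi + 1" "N \<le> n" using \<open>lo \<le> hi\<close> hi by (auto simp: N_def)
  have mom: "moments_agree (Suc k) N (\<lambda>i. ?t (a' + i)) (\<lambda>i. ?t (b' + i))"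
    using moments_agree_trim[OF Suc.prems(1), of lo N] out N hi
    by (force simp: a'_def b'_def add.assoc)
  have first: "?t (a' + 0) \<noteq> ?t (b' + 0)" using lo by (simp add: a'_def b'_def)
  have last: "?t (a' + (N - 1)) \<noteq> ?t (b' + (N - 1))"
  proof -
    have "lo + (N - 1) = hi" using N by simp
    then show ?thesis using hi by (simp add: a'_def b'_def add.assoc)
  qed
  \<comment> \<open>Since the induction starts at k = 1, orders 0 and 1 are available in every
    step.\<close>
  have mom2: "moments_agree 2 N (\<lambda>i. ?t (a' + i)) (\<lambda>i. ?t (b' + i))"
    using moments_agree_mono[OF mom] Suc.hyps by simp
  note mom2' = moments_agree_sym[OF mom2]
  have m: "int m > 0" using assms(1) by simp
  note block = thue_morse_block[OF assms(1)]
  \<comment> \<open>Alignment is obtained for the second word only, so the left-end result is also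
    applied with the roles exchanged.\<close>
  have "int m dvd int b'" "int m dvd int a'" "int m dvd int b' + int N"
    using left_end_aligned[OF m N(1) block block mom2 first]
      left_end_aligned[OF m N(1) block block mom2' first[symmetric]]
      right_end_aligned[OF m N(1) block block mom2 last] by blast+
  then have "m dvd a'" "m dvd b'" "m dvd N"
    by (auto simp: dvd_add_right_iff)
  then obtain a2 b2 l where e: "a' = m * a2" "b' = m * b2" "N = m * l" unfolding dvd_def by blast
  have rec: "?t (m * c + (m * q + s)) = (?t (c + q) + int s) mod int m" if "s < m" for c q s
    using thue_morse_rec[OF assms(1) that, of "c + q"] by (simp add: zmod_int algebra_simps)
  have "moments_agree k l (\<lambda>i. ?t (a2 + i)) (\<lambda>i. ?t (b2 + i))"
    using assms(1) mom thue_morse_less[OF assms(1)] unfolding e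
    by (intro moments_agree_desubstitute[of m k l "\<lambda>i. ?t (m * a2 + i)" "\<lambda>i. ?t (m * b2 + i)"] rec) auto
  \<comment> \<open>Block starts carry the letter of the preimage, so the preimages still differ at
    index 0.\<close>
  moreover have "thue_morse m (a2 + 0) \<noteq> thue_morse m (b2 + 0)"
    using first rec[of 0 a2 0] rec[of 0 b2 0] assms(1) by (auto simp: e)
  moreover have "0 < l" using N(1) e(3) by (cases l) auto
  ultimately have "2 * m ^ (k - 1) \<le> l" using Suc.IH by blast
  then have "m * (2 * m ^ (k - 1)) \<le> N" unfolding e by (rule mult_le_mono2)
  moreover have "m * (2 * m ^ (k - 1)) = 2 * m ^ (Suc k - 1)"
    using Suc.hyps by (cases k) simp_all
  ultimately show ?case using N(3) by linarith
qed

lemma binomially_equivalent_factors_length: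
  assumes "m \<ge> 2" "k \<ge> 1" "u \<in> factors (thue_morse m)" "v \<in> factors (thue_morse m)"
    and "u \<noteq> v" "binomially_equivalent k u v"
  shows "length u \<ge> 2 * m ^ (k - 1)" "length v \<ge> 2 * m ^ (k - 1)"
proof -
  have len: "length u = length v" using assms by (blast intro: binomially_equivalent_length)
  define n where "n = length u"
  obtain a b where ab: "u = map (thue_morse m) [a..<a + n]" "v = map (thue_morse m) [b..<b + n]"
  proof -
    have "\<exists>c. w = map (thue_morse m) [c..<c + length w]" if "w \<in> factors (thue_morse m)" for w
      using that by (auto simp: factors_def)
    then show ?thesis using assms(3,4) len that unfolding n_def by metis
  qed
  have "moments_agree k n (\<lambda>i. u ! i) (\<lambda>i. v ! i)"
    using assms(6) len by (intro binomially_equivalent_moments_agree) (auto simp: n_def)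
  \<comment> \<open>A test function on integer letters is composed with \<open>int\<close> to act on
    the natural letters.\<close>
  then have "(\<Sum>i<n. int i ^ j * (f (int (u ! i)) - f (int (v ! i)))) = 0" if "j < k" for j f
    using that by (rule moments_agree_D)
  then have "moments_agree k n (\<lambda>i. int (thue_morse m (a + i))) (\<lambda>i. int (thue_morse m (b + i)))"
    unfolding moments_agree_def ab by simp
  moreover have "\<exists>i<n. thue_morse m (a + i) \<noteq> thue_morse m (b + i)"
  proof (rule ccontr)
    assume "\<not> ?thesis"
    then have "u = v" unfolding ab by (intro nth_equalityI) auto
    then show False using assms(5) by simp
  qed
  ultimately have "n \<ge> 2 * m ^ (k - 1)"
    by (rule moments_agree_thue_morse_length[OF assms(1,2)])
  then show "length u \<ge> 2 * m ^ (k - 1)" "length v \<ge> 2 * m ^ (k - 1)" using len by (simp_all add: n_def)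
qed

section \<open>From the length bound to the complexities\<close>

lemma binomial_complexity_eq_factor_complexity:
  assumes "\<And>u v. u \<in> factors_of_length x n \<Longrightarrow> v \<in> factors_of_length x n \<Longrightarrow>
      binomially_equivalent k u v \<Longrightarrow> u = v"
  shows "binomial_complexity k x n = factor_complexity x n"
proof -
  let ?F = "factors_of_length x n"
  have "{(u, v). u \<in> ?F \<and> v \<in> ?F \<and> binomially_equivalent k u v} = Id_on ?F"
    using assms by (auto simp: binomially_equivalent_refl)
  moreover have "?F // Id_on ?F = (\<lambda>u. {u}) ` ?F"
    by (auto simp: quotient_def)
  ultimately show ?thesis
    by (simp add: binomial_complexity_def factor_complexity_def card_image)
qed

theorem theorem1p11:
  fixes m k :: nat
  assumes "m \<ge> 2" and "k \<ge> 2"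
  shows "(\<exists>u \<in> factors (thue_morse m). \<exists>v \<in> factors (thue_morse m).
            u \<noteq> v \<and> binomially_equivalent k u v \<and>
            length u = 2 * m ^ (k - 1) \<and> length v = 2 * m ^ (k - 1))
       \<and> (\<forall>u \<in> factors (thue_morse m). \<forall>v \<in> factors (thue_morse m).
            u \<noteq> v \<and> binomially_equivalent k u v \<longrightarrow>
            length u \<ge> 2 * m ^ (k - 1) \<and> length v \<ge> 2 * m ^ (k - 1))
       \<and> (\<forall>n < 2 * m ^ (k - 1).
            binomial_complexity k (thue_morse m) n = factor_complexity (thue_morse m) n)"
proof -
  have k: "k \<ge> 1" using assms(2) by simp
  note bound = binomially_equivalent_factors_length[OF assms(1) k]
  have "binomial_complexity k (thue_morse m) n = factor_complexity (thue_morse m) n"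
    if "n < 2 * m ^ (k - 1)" for n
  proof (rule binomial_complexity_eq_factor_complexity)
    fix u v
    assume "u \<in> factors_of_length (thue_morse m) n" "v \<in> factors_of_length (thue_morse m) n"
      "binomially_equivalent k u v"
    then show "u = v" using bound(1)[of u v] that by (fastforce simp: factors_of_length_def)
  qed
  then show ?thesis
    using ex_binomially_equivalent_factors[OF assms(1) k] bound by blast
qed

end
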